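(* Let $\langle A,\vee\rangle$ be a join-semilattice with a greatest element $1$, and let $I_1,I_2$ be subsemilattices of $A$. Then $A=I_1\oplus_1 I_2$ if and only if: (exi') $I_1\vee I_2=\{1\}$, i.e. $x_1\vee x_2=1$ for all $x_1\in I_1$, $x_2\in I_2$; (onto') $I_1\wedge I_2=A$, i.e. for all $x_1\in I_1$, $x_2\in I_2$ the infimum $x_1\wedge x_2$ exists, and every element of $A$ is of the form $x_1\wedge x_2$ with $x_1\in I_1$, $x_2\in I_2$; (Mod1') for all $x_1\in I_1$, $x_2\in I_2$ and all $y\in A$, $(x_1\wedge x_2)\vee y=(y\vee x_1)\wedge(y\vee x_2)$. Moreover, if $A=I_1\oplus_1 I_2$, then $I_1$ and $I_2$ are dual ideals of $A$ (upward closed sets).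
   Context: A join-semilattice $\langle A,\vee\rangle$ is a set with an idempotent, commutative, associative binary operation $\vee$, ordered by $a\le b$ iff $a\vee b=b$. The partial operation $a\wedge b$ denotes the infimum of $\{a,b\}$ when it exists. Convention: any equation $t_1=t_2$ involving $\wedge$ means "if either side exists, then the other also exists and they are equal". A subsemilattice is a subset closed under $\vee$. For fixed $c\in A$, $\phi_c(x_1,x_2,x)$ is the conjunction of: (dist) $x=(x\vee x_1)\wedge(x\vee x_2)$; (p1) $x_1=(x\vee x_1)\wedge(c\vee x_1)$; (p2) $x_2=(x\vee x_2)\wedge(c\vee x_2)$; (join) $x_1\vee x_2=x\vee c$. For subsemilattices $I_1,I_2$, $A=I_1\oplus_c I_2$ means all of the following hold: (Mod1) for all $x,y\in A$, $x_1\in I_1$, $x_2\in I_2$: if $x\vee c\ge x_1\vee x_2$ then $((x\vee x_1)\wedge(x\vee x_2))\vee y=(x\vee y\vee x_1)\wedge(x\vee y\vee x_2)$; (Mod2) for all $x,y\in A$, $x_1\in I_1$, $x_2\in I_2$: if $x\le x_1\vee x_2$ then $((x\vee x_i)\wedge(c\vee x_i))\vee y=(x\vee y\vee x_i)\wedge(c\vee y\vee x_i)$ for $i=1,2$; (Abs) for all $x_1,y_1\in I_1$, $z_2\in I_2$: $x_1\wedge(y_1\vee z_2)=x_1\wedge(y_1\vee c)$, and likewise with $I_1,I_2$ interchanged; (exi) for all $x_1\in I_1,x_2\in I_2$ there is $x\in A$ with $\phi_c(x_1,x_2,x)$; (onto) for all $x\in A$ there are $x_1\in I_1,x_2\in I_2$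 with $\phi_c(x_1,x_2,x)$. Here $A=I_1\oplus_1 I_2$ is this notion with $c=1$. *)

theory Defs
  imports "HOL-Library.Lub_Glb"
begin

unbundle lattice_syntax

(* The partial infimum is option-valued, so that HOL equality of options is exactly the convention
   for equations between partial terms: if one side exists, so does the other, and they are equal.
   A total term t compared with a partial one is written Some t, and joining y to a partial term u
   is written map_option (\<lambda>m. m \<squnion> y) u. *)
definition pmeet :: "'a::order \<Rightarrow> 'a \<Rightarrow> 'a option" where
  "pmeet a b =
     (if \<exists>m. isGlb UNIV {a, b} m then Some (THE m. isGlb UNIV {a, b} m) else None)"

definition subsemilattice :: "'a::semilattice_sup set \<Rightarrow> bool" where
  "subsemilattice I \<longleftrightarrow> (\<forall>a\<in>I. \<forall>b\<in>I. a \<squnion> b \<in> I)"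

definition dual_ideal :: "'a::semilattice_sup set \<Rightarrow> bool" where
  "dual_ideal I \<longleftrightarrow> (\<forall>a\<in>I. \<forall>b. a \<le> b \<longrightarrow> b \<in> I)"

definition phi :: "'a::semilattice_sup \<Rightarrow> 'a \<Rightarrow> 'a \<Rightarrow> 'a \<Rightarrow> bool" where
  "phi c x1 x2 x \<longleftrightarrow>
     Some x = pmeet (x \<squnion> x1) (x \<squnion> x2) \<and>
     Some x1 = pmeet (x \<squnion> x1) (c \<squnion> x1) \<and>
     Some x2 = pmeet (x \<squnion> x2) (c \<squnion> x2) \<and>
     x1 \<squnion> x2 = x \<squnion> c"

definition Mod1 :: "'a::semilattice_sup \<Rightarrow> 'a set \<Rightarrow> 'a set \<Rightarrow> bool" where
  "Mod1 c I1 I2 \<longleftrightarrow>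
     (\<forall>x y. \<forall>x1\<in>I1. \<forall>x2\<in>I2. x \<squnion> c \<ge> x1 \<squnion> x2 \<longrightarrow>
        map_option (\<lambda>m. m \<squnion> y) (pmeet (x \<squnion> x1) (x \<squnion> x2)) = pmeet (x \<squnion> y \<squnion> x1) (x \<squnion> y \<squnion> x2))"

definition Mod2 :: "'a::semilattice_sup \<Rightarrow> 'a set \<Rightarrow> 'a set \<Rightarrow> bool" where
  "Mod2 c I1 I2 \<longleftrightarrow>
     (\<forall>x y. \<forall>x1\<in>I1. \<forall>x2\<in>I2. x \<le> x1 \<squnion> x2 \<longrightarrow>
        map_option (\<lambda>m. m \<squnion> y) (pmeet (x \<squnion> x1) (c \<squnion> x1)) = pmeet (x \<squnion> y \<squnion> x1) (c \<squnion> y \<squnion> x1) \<and>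
        map_option (\<lambda>m. m \<squnion> y) (pmeet (x \<squnion> x2) (c \<squnion> x2)) = pmeet (x \<squnion> y \<squnion> x2) (c \<squnion> y \<squnion> x2))"

definition Abs :: "'a::semilattice_sup \<Rightarrow> 'a set \<Rightarrow> 'a set \<Rightarrow> bool" where
  "Abs c I1 I2 \<longleftrightarrow>
     (\<forall>x1\<in>I1. \<forall>y1\<in>I1. \<forall>z2\<in>I2. pmeet x1 (y1 \<squnion> z2) = pmeet x1 (y1 \<squnion> c)) \<and>
     (\<forall>x2\<in>I2. \<forall>y2\<in>I2. \<forall>z1\<in>I1. pmeet x2 (y2 \<squnion> z1) = pmeet x2 (y2 \<squnion> c))"

definition exi :: "'a::semilattice_sup \<Rightarrow> 'a set \<Rightarrow> 'a set \<Rightarrow> bool" where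
  "exi c I1 I2 \<longleftrightarrow> (\<forall>x1\<in>I1. \<forall>x2\<in>I2. \<exists>x. phi c x1 x2 x)"

definition onto :: "'a::semilattice_sup \<Rightarrow> 'a set \<Rightarrow> 'a set \<Rightarrow> bool" where
  "onto c I1 I2 \<longleftrightarrow> (\<forall>x. \<exists>x1\<in>I1. \<exists>x2\<in>I2. phi c x1 x2 x)"

(* A = I1 \<oplus>\<^sub>c I2, where A is the whole type; meant for subsemilattices I1, I2. *)
definition direct_sum :: "'a::semilattice_sup \<Rightarrow> 'a set \<Rightarrow> 'a set \<Rightarrow> bool" where
  "direct_sum c I1 I2 \<longleftrightarrow>
     Mod1 c I1 I2 \<and> Mod2 c I1 I2 \<and> Abs c I1 I2 \<and> exi c I1 I2 \<and> onto c I1 I2"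

lemma isGlb_pair_iff:
  "isGlb UNIV {a, b} m \<longleftrightarrow> m \<le> a \<and> m \<le> b \<and> (\<forall>l. l \<le> a \<longrightarrow> l \<le> b \<longrightarrow> l \<le> m)"
  for a b m :: "'a::order"
  by (auto simp: isGlb_def greatestP_def isLb_def setge_def setle_def)

lemma pmeet_eq_Some_iff: "pmeet a b = Some m \<longleftrightarrow> isGlb UNIV {a, b} m"
proof -
  have uniq: "m' = m" if "isGlb UNIV {a, b} m" "isGlb UNIV {a, b} m'" for m m'
    using that by (auto simp: isGlb_pair_iff intro: order.antisym)
  then have "(THE m. isGlb UNIV {a, b} m) = m" if "isGlb UNIV {a, b} m" for m
    using that by blast
  then show ?thesis
    by (auto simp: pmeet_def)
qed

end

(* For c = \<top> the condition phi c x1 x2 x says just that x1 \<squnion> x2 = \<top> and x is the infimum of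
   x1 and x2, while Mod2 and (given exi') Abs become trivial.  Mod1' is Mod1 at x = x1 \<sqinter> x2, and
   Mod1 is Mod1' applied twice.  If a \<in> I1 and a \<le> b = b1 \<sqinter> b2, then b2 = a \<squnion> b2 = \<top>, so
   b = b1 \<in> I1. *)
theory Submission
  imports Defs
begin

lemma pmeet_commute: "pmeet a b = pmeet b a"
  by (simp add: pmeet_def insert_commute)

lemma pmeet_absorb1: "a \<le> b \<Longrightarrow> pmeet a b = Some a"
  by (simp add: pmeet_eq_Some_iff isGlb_pair_iff)

lemma pmeet_top [simp]: "pmeet a \<top> = Some a" for a :: "'a::order_top"
  by (simp add: pmeet_absorb1)

lemma pmeet_SomeD:
  assumes "pmeet a b = Some m"
  shows "m \<le> a" "m \<le> b"
  using assms by (simp_all add: pmeet_eq_Some_iff isGlb_pair_iff)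

(* The library states these only for the class bounded_semilattice_sup_top, which is not implied by
   the sort used here. *)
lemma sup_top_semilattice [simp]:
  fixes x :: "'a::{semilattice_sup, order_top}"
  shows "x \<squnion> \<top> = \<top>" "\<top> \<squnion> x = \<top>"
  by (simp_all add: sup_absorb1 sup_absorb2)

text \<open>Meeting with \<top> changes nothing, so (p1) and (p2) reduce to
  \<open>xi = x \<squnion> xi\<close>, that is \<open>x \<le> xi\<close>. These bounds then strip
  \<open>x\<close> from both joins in (dist).\<close>

lemma phi_top_iff:
  fixes x1 x2 x :: "'a::{semilattice_sup, order_top}"
  shows "phi \<top> x1 x2 x \<longleftrightarrow> pmeet x1 x2 = Some x \<and> x1 \<squnion> x2 = \<top>"
proof -
  have "phi \<top> x1 x2 x \<longleftrightarrow>
      Some x = pmeet (x \<squnion> x1) (x \<squnion> x2) \<and> x \<le> x1 \<and> x \<le> x2 \<and> x1 \<squnion> x2 = \<top>"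
    by (auto simp: phi_def sup_absorb2 le_iff_sup)
  also have "\<dots> \<longleftrightarrow> pmeet x1 x2 = Some x \<and> x1 \<squnion> x2 = \<top>"
    \<comment> \<open>From right to left, the two bounds on \<open>x\<close> come back because an
      infimum is a lower bound.\<close>
    by (metis pmeet_SomeD sup_absorb2)
  finally show ?thesis .
qed

text \<open>Every meet in (Mod2) has \<top> as its second argument, so both sides are
  \<open>Some (x \<squnion> y \<squnion> xi)\<close>.\<close>

lemma Mod2_top: "Mod2 \<top> I1 I2" for I1 I2 :: "'a::{semilattice_sup, order_top} set"
  by (auto simp: Mod2_def ac_simps)

text \<open>The second arguments of the two meets in (Abs) are both \<top>.\<close>

lemma Abs_top:
  fixes I1 I2 :: "'a::{semilattice_sup, order_top} set"
  assumes "\<And>x1 x2. x1 \<in> I1 \<Longrightarrow> x2 \<in> I2 \<Longrightarrow> x1 \<squnion> x2 = \<top>"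
  shows "Abs \<top> I1 I2"
proof -
  have "x2 \<squnion> x1 = \<top>" if "x1 \<in> I1" "x2 \<in> I2" for x1 x2
    using assms [OF that] by (simp add: sup_commute)
  with assms show ?thesis
    by (simp add: Abs_def)
qed

lemma Mod1_top_iff:
  fixes I1 I2 :: "'a::{semilattice_sup, order_top} set"
  assumes ex: "\<And>x1 x2. x1 \<in> I1 \<Longrightarrow> x2 \<in> I2 \<Longrightarrow> \<exists>m. pmeet x1 x2 = Some m"
  shows "Mod1 \<top> I1 I2 \<longleftrightarrow>
    (\<forall>x1\<in>I1. \<forall>x2\<in>I2. \<forall>y.
       map_option (\<lambda>m. m \<squnion> y) (pmeet x1 x2) = pmeet (y \<squnion> x1) (y \<squnion> x2))"
    (is "_ \<longleftrightarrow> ?Mod1'")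
proof
  assume Mod1: "Mod1 \<top> I1 I2"
  show ?Mod1'
  proof (intro ballI allI)
    fix x1 x2 y
    assume x12: "x1 \<in> I1" "x2 \<in> I2"
    then obtain m where m: "pmeet x1 x2 = Some m"
      using ex by blast
    \<comment> \<open>Take \<open>x = m\<close>: the side condition holds as
      \<open>m \<squnion> \<top> = \<top>\<close>, and \<open>m\<close>, lying below
      \<open>x1\<close> and \<open>x2\<close>, is absorbed by them in all four joins.\<close>
    from Mod1 x12 have "map_option (\<lambda>m. m \<squnion> y) (pmeet (m \<squnion> x1) (m \<squnion> x2)) =
        pmeet (m \<squnion> y \<squnion> x1) (m \<squnion> y \<squnion> x2)"
      by (simp add: Mod1_def)
    with m show "map_option (\<lambda>m. m \<squnion> y) (pmeet x1 x2) = pmeet (y \<squnion> x1) (y \<squnion> x2)"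
      by (simp add: pmeet_SomeD [OF m] sup_absorb2 sup_assoc sup_left_commute [of m])
  qed
next
  assume Mod1': ?Mod1'
  show "Mod1 \<top> I1 I2"
    unfolding Mod1_def
  proof (intro allI ballI impI)
    fix x y x1 x2
    assume x12: "x1 \<in> I1" "x2 \<in> I2"
    then obtain m where m: "pmeet x1 x2 = Some m"
      using ex by blast
    \<comment> \<open>Used for \<open>z = x\<close> and for \<open>z = x \<squnion> y\<close>; both
      sides of (Mod1) become \<open>Some (m \<squnion> x \<squnion> y)\<close>.\<close>
    have "pmeet (z \<squnion> x1) (z \<squnion> x2) = Some (m \<squnion> z)" for z
      using Mod1' x12 m by (metis option.map(2))
    then show "map_option (\<lambda>m. m \<squnion> y) (pmeet (x \<squnion> x1) (x \<squnion> x2)) =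
        pmeet (x \<squnion> y \<squnion> x1) (x \<squnion> y \<squnion> x2)"
      by (simp flip: sup_assoc)
  qed
qed

text \<open>Stated for an arbitrary pair \<open>I\<close>, \<open>J\<close>, so that swapping the
  roles of \<open>I1\<close> and \<open>I2\<close> covers both of them.\<close>

lemma dual_ideal_if_complemented:
  fixes I J :: "'a::{semilattice_sup, order_top} set"
  assumes join: "\<And>x y. x \<in> I \<Longrightarrow> y \<in> J \<Longrightarrow> x \<squnion> y = \<top>"
    and decomp: "\<And>z. \<exists>x\<in>I. \<exists>y\<in>J. pmeet x y = Some z"
  shows "dual_ideal I"
  unfolding dual_ideal_def
proof (intro ballI allI impI)
  fix a b
  assume a: "a \<in> I" "a \<le> b"
  obtain x y where xy: "x \<in> I" "y \<in> J" "pmeet x y = Some b"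
    using decomp by blast
  have "a \<le> y"
    using a(2) pmeet_SomeD(2) [OF xy(3)] by (rule order_trans)
  then have "y = \<top>"
    using join [OF a(1) xy(2)] by (simp add: sup_absorb2)
  with xy show "b \<in> I"
    by simp
qed

theorem theorem3:
  fixes I1 I2 :: "'a::{semilattice_sup, order_top} set"
  assumes "subsemilattice I1" and "subsemilattice I2"
  shows "(direct_sum \<top> I1 I2 \<longleftrightarrow>
           (\<forall>x1\<in>I1. \<forall>x2\<in>I2. x1 \<squnion> x2 = \<top>) \<and>
           ((\<forall>x1\<in>I1. \<forall>x2\<in>I2. \<exists>m. pmeet x1 x2 = Some m) \<and>
            (\<forall>x. \<exists>x1\<in>I1. \<exists>x2\<in>I2. pmeet x1 x2 = Some x)) \<and>
           (\<forall>x1\<in>I1. \<forall>x2\<in>I2. \<forall>y.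
              map_option (\<lambda>m. m \<squnion> y) (pmeet x1 x2) = pmeet (y \<squnion> x1) (y \<squnion> x2)))
         \<and> (direct_sum \<top> I1 I2 \<longrightarrow> dual_ideal I1 \<and> dual_ideal I2)"
proof -
  let ?exi' = "\<forall>x1\<in>I1. \<forall>x2\<in>I2. x1 \<squnion> x2 = \<top>"
  let ?meets = "\<forall>x1\<in>I1. \<forall>x2\<in>I2. \<exists>m. pmeet x1 x2 = Some m"
  let ?decomp = "\<forall>x. \<exists>x1\<in>I1. \<exists>x2\<in>I2. pmeet x1 x2 = Some x"
  \<comment> \<open>The join condition in \<open>phi_top_iff\<close> does not mention
    \<open>x\<close>, so it moves out of the existential quantifier.\<close>
  have exi: "exi \<top> I1 I2 \<longleftrightarrow> ?exi' \<and> ?meets"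
    by (auto simp: exi_def phi_top_iff)
  have onto: "onto \<top> I1 I2 \<longleftrightarrow> ?decomp" if ?exi'
    \<comment> \<open>The congruence rule supplies the memberships under which \<open>?exi'\<close>
      discharges the join condition.\<close>
    using that by (simp add: onto_def phi_top_iff cong: bex_cong)
  have "dual_ideal I1" "dual_ideal I2" if ?exi' ?decomp
  proof -
    show "dual_ideal I1"
      using that by (intro dual_ideal_if_complemented [of I1 I2]) auto
    show "dual_ideal I2"
      using that by (intro dual_ideal_if_complemented [of I2 I1])
        (metis sup_commute, metis pmeet_commute)
  qed
  \<comment> \<open>\<open>exi\<close> yields \<open>?exi'\<close>, which is what makes
    \<open>onto\<close> and \<open>Abs_top\<close> applicable.\<close>
  moreover have "direct_sum \<top> I1 I2 \<longleftrightarrow> ?exi' \<and> ?meets \<and> ?decomp \<and> Mod1 \<top> I1 I2"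
    using exi onto Mod2_top [of I1 I2] Abs_top [of I1 I2] unfolding direct_sum_def by blast
  ultimately show ?thesis
    using Mod1_top_iff [of I1 I2] by blast
qed

end
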